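(* Let $X$ and $Y$ be Tychonoff spaces. If the graphs $\Gamma(C_{+}(X))$ and $\Gamma(C_{+}(Y))$ are isomorphic, then the graphs $\Gamma(C(X))$ and $\Gamma(C(Y))$ are isomorphic.
   Context: For a Tychonoff space $X$, $C(X)$ is the ring of real-valued continuous functions on $X$ and $C_{+}(X)$ is the semiring of non-negative real-valued continuous functions on $X$. For $f\in C(X)$, $Z(f)=\{x\in X: f(x)=0\}$. Let $\mathcal{N}(X)$ be the set of non-units of $C(X)$ (functions with $Z(f)\neq\emptyset$) and $\mathcal{N}'(X)=\mathcal{N}(X)\cap C_{+}(X)$, the set of non-units of $C_{+}(X)$. The zero-set intersection graph $\Gamma(C(X))$ has vertex set $\mathcal{N}(X)$, and $\Gamma(C_{+}(X))$ has vertex set $\mathcal{N}'(X)$; in each, distinct vertices $f,g$ are adjacent iff $Z(f)\cap Z(g)\neq\emptyset$. A graph isomorphism is a bijection between vertex sets such that two vertices are adjacent iff their images are adjacent. *)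

theory Defs
  imports "HOL-Analysis.Analysis"
begin

definition Tychonoff_space :: "'a topology \<Rightarrow> bool" where
  "Tychonoff_space X \<longleftrightarrow> completely_regular_space X \<and> Hausdorff_space X"

text \<open>A topology lives on a carrier \<^term>\<open>topspace X\<close> that may be a proper subset of the type.
  Elements of $C(X)$ are taken to be extensional (constantly \<^term>\<open>undefined\<close> off the carrier),
  so that equality of HOL functions in $C(X)$ is equality of functions on $X$.\<close>

definition cont_fun :: "'a topology \<Rightarrow> ('a \<Rightarrow> real) set" where
  "cont_fun X = {f \<in> extensional (topspace X). continuous_map X euclideanreal f}"

definition cont_fun_nonneg :: "'a topology \<Rightarrow> ('a \<Rightarrow> real) set" where
  "cont_fun_nonneg X = {f \<in> cont_fun X. \<forall>x\<in>topspace X. 0 \<le> f x}"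

definition zero_set :: "'a topology \<Rightarrow> ('a \<Rightarrow> real) \<Rightarrow> 'a set" where
  "zero_set X f = {x \<in> topspace X. f x = 0}"

definition nonunits :: "'a topology \<Rightarrow> ('a \<Rightarrow> real) set" where
  "nonunits X = {f \<in> cont_fun X. \<not> (\<exists>g\<in>cont_fun X. \<forall>x\<in>topspace X. f x * g x = 1)}"

definition nonunits_nonneg :: "'a topology \<Rightarrow> ('a \<Rightarrow> real) set" where
  "nonunits_nonneg X = nonunits X \<inter> cont_fun_nonneg X"

lemma inverse_in_cont_fun:
  assumes "f \<in> cont_fun X" "zero_set X f = {}"
  shows "restrict (\<lambda>x. inverse (f x)) (topspace X) \<in> cont_fun X"
proof -
  have "continuous_map X euclideanreal (\<lambda>x. inverse (f x))"
    using assms by (intro continuous_map_real_inverse) (auto simp: cont_fun_def zero_set_def)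
  then show ?thesis
    by (auto simp: cont_fun_def elim: continuous_map_eq)
qed

lemma nonunits_iff_zero_set:
  "f \<in> nonunits X \<longleftrightarrow> f \<in> cont_fun X \<and> zero_set X f \<noteq> {}"
proof
  assume f: "f \<in> nonunits X"
  have "zero_set X f \<noteq> {}"
  proof
    assume Z: "zero_set X f = {}"
    let ?g = "restrict (\<lambda>x. inverse (f x)) (topspace X)"
    have "?g \<in> cont_fun X"
      using f Z by (intro inverse_in_cont_fun) (auto simp: nonunits_def)
    moreover have "\<forall>x\<in>topspace X. f x * ?g x = 1"
      using Z by (auto simp: zero_set_def)
    ultimately show False
      using f unfolding nonunits_def by blast
  qed
  then show "f \<in> cont_fun X \<and> zero_set X f \<noteq> {}"
    using f by (simp add: nonunits_def)
next
  assume "f \<in> cont_fun X \<and> zero_set X f \<noteq> {}"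
  then show "f \<in> nonunits X"
    by (fastforce simp: nonunits_def zero_set_def)
qed

lemma nonunits_nonneg_eq:
  "nonunits_nonneg X =
    {f \<in> cont_fun_nonneg X. \<not> (\<exists>g\<in>cont_fun_nonneg X. \<forall>x\<in>topspace X. f x * g x = 1)}"
proof -
  have inv_nonneg: "\<exists>g\<in>cont_fun_nonneg X. \<forall>x\<in>topspace X. f x * g x = 1"
    if f: "f \<in> cont_fun_nonneg X" and g: "g \<in> cont_fun X" "\<forall>x\<in>topspace X. f x * g x = 1" for f g
  proof (intro bexI[where x = g])
    have "0 \<le> g x" if x: "x \<in> topspace X" for x
    proof -
      have "0 \<le> f x" "f x * g x = 1"
        using f g x by (auto simp: cont_fun_nonneg_def)
      then show ?thesis
        by (metis mult_nonneg_nonpos not_one_le_zero linear)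
    qed
    then show "g \<in> cont_fun_nonneg X"
      using g by (simp add: cont_fun_nonneg_def)
  qed (use g in blast)
  have sub: "cont_fun_nonneg X \<subseteq> cont_fun X"
    by (auto simp: cont_fun_nonneg_def)
  show ?thesis
    unfolding nonunits_nonneg_def nonunits_def using inv_nonneg sub by blast
qed

text \<open>A simple graph is a pair of a vertex set and a set of two-element sets of vertices.\<close>

type_synonym 'v sgraph = "'v set \<times> 'v set set"

definition graph_isomorphic :: "'v sgraph \<Rightarrow> 'w sgraph \<Rightarrow> bool" where
  "graph_isomorphic G H \<longleftrightarrow>
    (\<exists>\<phi>. bij_betw \<phi> (fst G) (fst H) \<and>
      (\<forall>u\<in>fst G. \<forall>v\<in>fst G. {u, v} \<in> snd G \<longleftrightarrow> {\<phi> u, \<phi> v} \<in> snd H))"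

definition zero_set_graph_on ::
    "'a topology \<Rightarrow> ('a \<Rightarrow> real) set \<Rightarrow> ('a \<Rightarrow> real) sgraph" where
  "zero_set_graph_on X V =
    (V, {{f, g} | f g. f \<in> V \<and> g \<in> V \<and> f \<noteq> g \<and> zero_set X f \<inter> zero_set X g \<noteq> {}})"

definition zero_set_graph :: "'a topology \<Rightarrow> ('a \<Rightarrow> real) sgraph" where
  "zero_set_graph X = zero_set_graph_on X (nonunits X)"

definition zero_set_graph_nonneg :: "'a topology \<Rightarrow> ('a \<Rightarrow> real) sgraph" where
  "zero_set_graph_nonneg X = zero_set_graph_on X (nonunits_nonneg X)"

lemma zero_set_graph_on_adjacent_iff:
  "{f, g} \<in> snd (zero_set_graph_on X V) \<longleftrightarrow>
    f \<in> V \<and> g \<in> V \<and> f \<noteq> g \<and> zero_set X f \<inter> zero_set X g \<noteq> {}"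
  by (auto simp: zero_set_graph_on_def doubleton_eq_iff)

end

theory Submission
  imports Defs "HOL-Library.Equipollence"
begin

text \<open>On non-units, \<open>Z(f) \<inter> Z(g) \<noteq> \<emptyset>\<close> is adjacency made reflexive, so an isomorphism of the graphs of
  \<open>C\<^sub>+\<close> preserves this relation. By complete regularity two non-negative non-units have the same zero
  set iff they are related to the same vertices; hence the isomorphism induces a bijection \<open>\<sigma>\<close>
  between the nonempty zero sets of \<open>X\<close> and \<open>Y\<close> which preserves intersection, together with
  bijections between the sets of non-negative functions vanishing exactly on \<open>A\<close> and on \<open>\<sigma> A\<close>.
  It remains to see that there are as many \<open>f\<close> in \<open>C\<close> with zero set \<open>A\<close> as in \<open>C\<^sub>+\<close>. If \<open>A\<close> is
  the whole space there is only the zero function. Otherwise both sets are infinite, and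
  \<open>f \<mapsto> (\<bar>f\<bar>, 2\<bar>f\<bar> + f)\<close> injects the first one into the square of the second.\<close>

lemma infinite_Times_lepoll_self:
  assumes "infinite A"
  shows "A \<times> A \<lesssim> A"
  using ordIso_imp_ordLeq[OF card_of_Times_same_infinite[OF assms]]
  by (simp add: lepoll_def card_of_ordLeq)

text \<open>A bijection is chosen on each fibre and the choices are glued. Injectivity of
  \<open>\<sigma>\<close> separates the images of different fibres, and its surjectivity makes them
  exhaust \<open>T\<close>. That \<open>\<psi>\<close> lies over \<open>\<sigma>\<close> is what
  later transports adjacency.\<close>

lemma bij_betw_fibrewise:
  assumes \<sigma>: "bij_betw \<sigma> (p ` S) (q ` T)"
    and fib: "\<And>i. i \<in> p ` S \<Longrightarrow> {s \<in> S. p s = i} \<approx> {t \<in> T. q t = \<sigma> i}"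
  obtains \<psi> where "bij_betw \<psi> S T" "\<And>s. s \<in> S \<Longrightarrow> q (\<psi> s) = \<sigma> (p s)"
proof -
  obtain b where b: "\<And>i. i \<in> p ` S \<Longrightarrow> bij_betw (b i) {s \<in> S. p s = i} {t \<in> T. q t = \<sigma> i}"
    using fib unfolding eqpoll_def by metis
  define \<psi> where "\<psi> s = b (p s) s" for s
  have \<psi>: "\<psi> s \<in> T" "q (\<psi> s) = \<sigma> (p s)" if "s \<in> S" for s
    using bij_betwE[OF b, of "p s"] that by (auto simp: \<psi>_def)
  have "inj_on \<psi> S"
  proof (rule inj_onI)
    fix s t assume st: "s \<in> S" "t \<in> S" "\<psi> s = \<psi> t"
    then have "p s = p t"
      using \<psi> \<sigma> by (metis bij_betw_inv_into_left imageI)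
    then show "s = t"
      using st b[of "p s"] by (auto simp: \<psi>_def bij_betw_def inj_on_def)
  qed
  moreover have "t \<in> \<psi> ` S" if t: "t \<in> T" for t
  proof -
    obtain i where i: "i \<in> p ` S" "q t = \<sigma> i"
      using t \<sigma> by (metis bij_betw_imp_surj_on imageE imageI)
    then obtain s where "s \<in> S" "p s = i" "b i s = t"
      using b[OF i(1)] t unfolding bij_betw_def by (smt (verit) imageE mem_Collect_eq)
    then show ?thesis
      by (auto simp: \<psi>_def)
  qed
  ultimately have "bij_betw \<psi> S T"
    using \<psi> by (auto simp: bij_betw_def)
  with \<psi>(2) that show ?thesis
    by blast
qed

lemma restrict_in_cont_fun:
  assumes "continuous_map X euclideanreal f"
  shows "restrict f (topspace X) \<in> cont_fun X"
  using assms by (auto simp: cont_fun_def elim: continuous_map_eq)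

lemma nonunits_nonneg_iff:
  "f \<in> nonunits_nonneg X \<longleftrightarrow>
    f \<in> cont_fun X \<and> zero_set X f \<noteq> {} \<and> (\<forall>x\<in>topspace X. 0 \<le> f x)"
  by (auto simp: nonunits_nonneg_def nonunits_iff_zero_set cont_fun_nonneg_def)

text \<open>The common source of non-negative functions with a prescribed zero set. Restricting
  supplies the extensionality that \<open>cont_fun\<close> demands.\<close>

lemma restrict_in_nonunits_nonneg:
  assumes "f \<in> nonunits X" "continuous_map X euclideanreal g"
    and "\<And>x. x \<in> topspace X \<Longrightarrow> 0 \<le> g x"
    and "\<And>x. x \<in> topspace X \<Longrightarrow> g x = 0 \<longleftrightarrow> f x = 0"
  shows "restrict g (topspace X) \<in> {h \<in> nonunits_nonneg X. zero_set X h = zero_set X f}"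
proof -
  have "zero_set X (restrict g (topspace X)) = zero_set X f"
    using assms(4) by (auto simp: zero_set_def)
  then show ?thesis
    using assms(1,3) restrict_in_cont_fun[OF assms(2)]
    by (auto simp: nonunits_nonneg_iff nonunits_iff_zero_set)
qed

lemma abs_in_nonunits_nonneg:
  assumes "f \<in> nonunits X"
  shows "restrict (\<lambda>x. \<bar>f x\<bar>) (topspace X) \<in> {h \<in> nonunits_nonneg X. zero_set X h = zero_set X f}"
  using assms
  by (intro restrict_in_nonunits_nonneg)
     (auto simp: nonunits_iff_zero_set cont_fun_def intro: continuous_map_real_abs)

lemma image_zero_set_nonunits:
  "zero_set X ` nonunits X = zero_set X ` nonunits_nonneg X"
proof
  show "zero_set X ` nonunits X \<subseteq> zero_set X ` nonunits_nonneg X"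
  proof
    fix A assume "A \<in> zero_set X ` nonunits X"
    then obtain f where "f \<in> nonunits X" "A = zero_set X f"
      by blast
    with abs_in_nonunits_nonneg[of f X] show "A \<in> zero_set X ` nonunits_nonneg X"
      by (intro image_eqI[where x = "restrict (\<lambda>x. \<bar>f x\<bar>) (topspace X)"]) auto
  qed
qed (auto simp: nonunits_nonneg_def)

lemma zero_set_fibre_eqpoll:
  assumes f: "f \<in> nonunits X"
  shows "{h \<in> nonunits X. zero_set X h = zero_set X f} \<approx>
    {h \<in> nonunits_nonneg X. zero_set X h = zero_set X f}" (is "?F \<approx> ?P")
proof (cases "zero_set X f = topspace X")
  case True
  have "?F \<subseteq> ?P"
  proof
    fix h assume h: "h \<in> ?F"
    then have "h x = 0" if "x \<in> topspace X" for x
      using True that by (auto simp: zero_set_def)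
    with h show "h \<in> ?P"
      by (auto simp: nonunits_nonneg_iff nonunits_iff_zero_set)
  qed
  moreover have "?P \<subseteq> ?F"
    by (auto simp: nonunits_nonneg_def)
  ultimately have "?F = ?P"
    by (rule subset_antisym)
  then show ?thesis
    by (rule ssubst) (rule eqpoll_refl)
next
  case False
  then obtain a where a: "a \<in> topspace X" "f a \<noteq> 0"
    by (auto simp: zero_set_def)
  have cf: "continuous_map X euclideanreal f"
    using f by (simp add: nonunits_iff_zero_set cont_fun_def)
  \<comment> \<open>Positive multiples of \<bar>f\<bar> keep the zero set, which is why the factor
    is \<open>Suc n\<close> and not \<open>n\<close>; their values at \<open>a\<close> tell them
    apart.\<close>
  let ?m = "\<lambda>n::nat. restrict (\<lambda>x. real (Suc n) * \<bar>f x\<bar>) (topspace X)"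
  have "?m n \<in> ?P" for n
    using f cf by (intro restrict_in_nonunits_nonneg)
      (auto intro!: continuous_map_real_abs continuous_map_real_mult)
  then have "range ?m \<subseteq> ?P"
    by blast
  moreover have "inj ?m"
  proof (rule injI)
    fix m n assume "?m m = ?m n"
    then have "?m m a = ?m n a"
      by (rule fun_cong)
    then show "m = n"
      using a by simp
  qed
  ultimately have inf: "infinite ?P"
    using range_inj_infinite infinite_super by blast
  \<comment> \<open>Since 2\<bar>h\<bar> + h \<ge> \<bar>h\<bar>, the second component is
    non-negative and vanishes exactly where \<open>h\<close> does. Subtracting twice the first
    component from it recovers \<open>h\<close>.\<close>
  let ?e = "\<lambda>h. (restrict (\<lambda>x. \<bar>h x\<bar>) (topspace X), restrict (\<lambda>x. 2 * \<bar>h x\<bar> + h x) (topspace X))"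
  have "?F \<lesssim> ?P \<times> ?P"
    unfolding lepoll_def
  proof (intro exI[of _ ?e] conjI)
    show "inj_on ?e ?F"
    proof (rule inj_onI)
      fix g h assume gh: "g \<in> ?F" "h \<in> ?F" and eq: "?e g = ?e h"
      have "g x = h x" if x: "x \<in> topspace X" for x
      proof -
        show ?thesis
          using arg_cong[OF eq, of "\<lambda>p. fst p x"] arg_cong[OF eq, of "\<lambda>p. snd p x"] x by simp
      qed
      with gh show "g = h"
        by (intro extensionalityI[of g "topspace X" h])
           (auto simp: nonunits_iff_zero_set cont_fun_def)
    qed
    show "?e ` ?F \<subseteq> ?P \<times> ?P"
    proof (rule image_subsetI)
      fix h assume h: "h \<in> ?F"
      then have "continuous_map X euclideanreal h"
        by (simp add: nonunits_iff_zero_set cont_fun_def)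
      then have "restrict (\<lambda>x. 2 * \<bar>h x\<bar> + h x) (topspace X)
          \<in> {g \<in> nonunits_nonneg X. zero_set X g = zero_set X h}"
        using h by (intro restrict_in_nonunits_nonneg)
          (auto intro!: continuous_map_add continuous_map_real_abs continuous_map_real_mult)
      with h abs_in_nonunits_nonneg[of h X] show "?e h \<in> ?P \<times> ?P"
        by auto
    qed
  qed
  also have "?P \<times> ?P \<lesssim> ?P"
    using inf by (rule infinite_Times_lepoll_self)
  finally have "?F \<lesssim> ?P" .
  moreover have "?P \<lesssim> ?F"
    by (rule subset_imp_lepoll) (auto simp: nonunits_nonneg_def)
  ultimately show ?thesis
    by (rule lepoll_antisym)
qed

text \<open>A point of Z(f) outside the closed set Z(g) could be separated from it by a function
  \<open>h\<close> into [0,1] that is 0 at the point and 1 on Z(g). Such an \<open>h\<close> is a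
  non-negative non-unit whose zero set meets Z(f) but not Z(g).\<close>

lemma zero_set_subset_if_neighbours:
  assumes X: "completely_regular_space X"
    and g: "g \<in> nonunits X"
    and nb: "\<And>h. h \<in> nonunits_nonneg X \<Longrightarrow> zero_set X f \<inter> zero_set X h \<noteq> {}
      \<Longrightarrow> zero_set X g \<inter> zero_set X h \<noteq> {}"
  shows "zero_set X f \<subseteq> zero_set X g"
proof (rule ccontr)
  assume "\<not> zero_set X f \<subseteq> zero_set X g"
  then obtain x where x: "x \<in> zero_set X f" "x \<in> topspace X - zero_set X g"
    by (auto simp: zero_set_def)
  have "continuous_map X euclideanreal g"
    using g by (simp add: nonunits_iff_zero_set cont_fun_def)
  then have "closedin X {y \<in> topspace X. g y \<in> {0}}"
    by (rule closedin_continuous_map_preimage) simp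
  then have "closedin X (zero_set X g)"
    by (simp add: zero_set_def)
  then obtain h where h: "continuous_map X (top_of_set {0..1::real}) h"
      "h x = 0" "h ` zero_set X g \<subseteq> {1}"
    using X x(2) unfolding completely_regular_space_def by blast
  let ?h = "restrict h (topspace X)"
  have "continuous_map X euclideanreal h" "h \<in> topspace X \<rightarrow> {0..1}"
    using h(1) by (auto simp: continuous_map_in_subtopology)
  then have "?h \<in> cont_fun X" "\<forall>y\<in>topspace X. 0 \<le> ?h y"
    by (auto intro: restrict_in_cont_fun)
  moreover have xh: "x \<in> zero_set X ?h"
    using h(2) x(2) by (auto simp: zero_set_def)
  ultimately have "?h \<in> nonunits_nonneg X"
    by (auto simp: nonunits_nonneg_iff)
  then have "zero_set X g \<inter> zero_set X ?h \<noteq> {}"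
    using nb x(1) xh by blast
  then show False
    using h(3) by (force simp: zero_set_def)
qed

text \<open>This expresses equality of zero sets through the intersection relation on vertices
  alone, so that a graph isomorphism must respect it.\<close>

lemma zero_set_eq_iff_neighbours:
  assumes "completely_regular_space X" "f \<in> nonunits_nonneg X" "g \<in> nonunits_nonneg X"
  shows "zero_set X f = zero_set X g \<longleftrightarrow>
    (\<forall>h\<in>nonunits_nonneg X. zero_set X f \<inter> zero_set X h \<noteq> {} \<longleftrightarrow> zero_set X g \<inter> zero_set X h \<noteq> {})"
    (is "_ \<longleftrightarrow> ?R")
proof
  assume R: ?R
  show "zero_set X f = zero_set X g"
  proof (rule subset_antisym)
    show "zero_set X f \<subseteq> zero_set X g"
      using assms R by (intro zero_set_subset_if_neighbours) (auto simp: nonunits_nonneg_def)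
    show "zero_set X g \<subseteq> zero_set X f"
      using assms R by (intro zero_set_subset_if_neighbours) (auto simp: nonunits_nonneg_def)
  qed
qed simp

lemma fst_zero_set_graph: "fst (zero_set_graph X) = nonunits X"
  by (simp add: zero_set_graph_def zero_set_graph_on_def)

lemma fst_zero_set_graph_nonneg: "fst (zero_set_graph_nonneg X) = nonunits_nonneg X"
  by (simp add: zero_set_graph_nonneg_def zero_set_graph_on_def)

theorem theorem4p8:
  fixes X :: "'a topology" and Y :: "'b topology"
  assumes "Tychonoff_space X" and "Tychonoff_space Y"
    and "graph_isomorphic (zero_set_graph_nonneg X) (zero_set_graph_nonneg Y)"
  shows "graph_isomorphic (zero_set_graph X) (zero_set_graph Y)"
proof -
  let ?P = "nonunits_nonneg X" and ?Q = "nonunits_nonneg Y"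
  have X: "completely_regular_space X" and Y: "completely_regular_space Y"
    using assms(1,2) by (auto simp: Tychonoff_space_def)
  obtain \<phi> where \<phi>: "bij_betw \<phi> ?P ?Q"
    and adj: "\<And>u v. u \<in> ?P \<Longrightarrow> v \<in> ?P \<Longrightarrow> {u, v} \<in> snd (zero_set_graph_nonneg X) \<longleftrightarrow>
      {\<phi> u, \<phi> v} \<in> snd (zero_set_graph_nonneg Y)"
    using assms(3) unfolding graph_isomorphic_def fst_zero_set_graph_nonneg by blast
  have \<phi>Q: "\<phi> u \<in> ?Q" if "u \<in> ?P" for u
    using \<phi> that by (rule bij_betw_apply)
  have \<phi>_inj: "\<phi> u = \<phi> v \<longleftrightarrow> u = v" if "u \<in> ?P" "v \<in> ?P" for u v
    using \<phi> that by (auto simp: bij_betw_def inj_on_eq_iff)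
  \<comment> \<open>Adjacency says nothing about u = v; there both sides hold because non-units have
    nonempty zero sets.\<close>
  have meet: "zero_set X u \<inter> zero_set X v \<noteq> {} \<longleftrightarrow> zero_set Y (\<phi> u) \<inter> zero_set Y (\<phi> v) \<noteq> {}"
    if uv: "u \<in> ?P" "v \<in> ?P" for u v
  proof (cases "u = v")
    case True
    then show ?thesis
      using uv(1) \<phi>Q[OF uv(1)] by (simp add: nonunits_nonneg_iff)
  next
    case False
    then show ?thesis
      using adj[OF uv] uv \<phi>Q \<phi>_inj
      by (simp add: zero_set_graph_nonneg_def zero_set_graph_on_adjacent_iff)
  qed
  have \<phi>_eq: "zero_set X u = zero_set X v \<longleftrightarrow> zero_set Y (\<phi> u) = zero_set Y (\<phi> v)"
    if uv: "u \<in> ?P" "v \<in> ?P" for u v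
  proof -
    have "zero_set X u = zero_set X v \<longleftrightarrow> (\<forall>w\<in>?P.
        zero_set Y (\<phi> u) \<inter> zero_set Y (\<phi> w) \<noteq> {} \<longleftrightarrow> zero_set Y (\<phi> v) \<inter> zero_set Y (\<phi> w) \<noteq> {})"
      using zero_set_eq_iff_neighbours[OF X uv] meet uv by simp
    \<comment> \<open>As \<phi> is onto \<open>?Q\<close>, testing against all images is testing
      against all vertices of the second graph, so the criterion applies in
      \<open>Y\<close>.\<close>
    also have "\<dots> \<longleftrightarrow> (\<forall>h\<in>\<phi> ` ?P.
        zero_set Y (\<phi> u) \<inter> zero_set Y h \<noteq> {} \<longleftrightarrow> zero_set Y (\<phi> v) \<inter> zero_set Y h \<noteq> {})"
      by (simp only: ball_simps)
    also have "\<dots> \<longleftrightarrow> zero_set Y (\<phi> u) = zero_set Y (\<phi> v)"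
      using zero_set_eq_iff_neighbours[OF Y] uv \<phi>Q \<phi> by (simp add: bij_betw_imp_surj_on)
    finally show ?thesis .
  qed
  \<comment> \<open>An arbitrary non-negative representative of \<open>A\<close> is chosen; by
    \<open>\<phi>_eq\<close> the value does not depend on the choice.\<close>
  define \<sigma> where "\<sigma> A = zero_set Y (\<phi> (SOME u. u \<in> ?P \<and> zero_set X u = A))" for A
  have \<sigma>: "\<sigma> (zero_set X u) = zero_set Y (\<phi> u)" if "u \<in> ?P" for u
  proof -
    let ?v = "SOME v. v \<in> ?P \<and> zero_set X v = zero_set X u"
    have "?v \<in> ?P \<and> zero_set X ?v = zero_set X u"
      using that by (rule someI[of _ u, OF conjI]) simp
    then have "zero_set Y (\<phi> ?v) = zero_set Y (\<phi> u)"
      using \<phi>_eq[of ?v u] that by blast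
    then show ?thesis
      unfolding \<sigma>_def .
  qed
  have zX: "zero_set X ` nonunits X = zero_set X ` ?P"
    and zY: "zero_set Y ` nonunits Y = zero_set Y ` ?Q"
    by (rule image_zero_set_nonunits)+
  have "\<sigma> ` zero_set X ` ?P = zero_set Y ` \<phi> ` ?P"
    unfolding image_image using \<sigma> by (rule image_cong[OF refl])
  moreover have "\<phi> ` ?P = ?Q"
    using \<phi> by (rule bij_betw_imp_surj_on)
  moreover have "inj_on \<sigma> (zero_set X ` ?P)"
    using \<sigma> \<phi>_eq by (fastforce intro: inj_onI)
  ultimately have bij: "bij_betw \<sigma> (zero_set X ` nonunits X) (zero_set Y ` nonunits Y)"
    unfolding zX zY bij_betw_def by simp
  \<comment> \<open>The equipollence passes through the non-negative fibres: \<phi> matches these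
    with each other, and each is as large as the full fibre over the same zero set.\<close>
  have fib: "{f \<in> nonunits X. zero_set X f = A} \<approx> {g \<in> nonunits Y. zero_set Y g = \<sigma> A}"
    if A: "A \<in> zero_set X ` nonunits X" for A
  proof -
    obtain u where u: "u \<in> ?P" "A = zero_set X u"
      using A unfolding zX by blast
    have "bij_betw \<phi> {f \<in> ?P. zero_set X f = A} {g \<in> ?Q. zero_set Y g = \<sigma> A}"
      unfolding bij_betw_def
    proof
      show "inj_on \<phi> {f \<in> ?P. zero_set X f = A}"
        using \<phi>_inj by (auto intro!: inj_onI)
      have "?Q = \<phi> ` ?P"
        using \<phi> by (simp add: bij_betw_imp_surj_on)
      then show "\<phi> ` {f \<in> ?P. zero_set X f = A} = {g \<in> ?Q. zero_set Y g = \<sigma> A}"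
        using u \<sigma>[OF u(1)] \<phi>_eq[OF _ u(1)] by auto
    qed
    then have "{f \<in> ?P. zero_set X f = A} \<approx> {g \<in> ?Q. zero_set Y g = \<sigma> A}"
      unfolding eqpoll_def by blast
    moreover have "{f \<in> nonunits X. zero_set X f = A} \<approx> {f \<in> ?P. zero_set X f = A}"
      unfolding u(2) using u(1) by (intro zero_set_fibre_eqpoll) (simp add: nonunits_nonneg_def)
    moreover have "{g \<in> nonunits Y. zero_set Y g = \<sigma> A} \<approx> {g \<in> ?Q. zero_set Y g = \<sigma> A}"
      unfolding u(2) \<sigma>[OF u(1)] using \<phi>Q[OF u(1)]
      by (intro zero_set_fibre_eqpoll) (simp add: nonunits_nonneg_def)
    ultimately show ?thesis
      by (meson eqpoll_sym eqpoll_trans)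
  qed
  obtain \<psi> where \<psi>: "bij_betw \<psi> (nonunits X) (nonunits Y)"
    and \<psi>Z: "\<And>f. f \<in> nonunits X \<Longrightarrow> zero_set Y (\<psi> f) = \<sigma> (zero_set X f)"
    using bij_betw_fibrewise[OF bij fib] by blast
  \<comment> \<open>By \<open>zX\<close> both sets have non-negative representatives, to which
    \<open>meet\<close> applies.\<close>
  have \<sigma>_meet: "A \<inter> B \<noteq> {} \<longleftrightarrow> \<sigma> A \<inter> \<sigma> B \<noteq> {}"
    if "A \<in> zero_set X ` nonunits X" "B \<in> zero_set X ` nonunits X" for A B
    using that unfolding zX by (elim imageE) (simp only: meet \<sigma>)
  \<comment> \<open>Here \<psi> need not extend \<phi>: adjacency depends only on distinctness, kept
    by injectivity, and on the zero sets, which \<psi> moves by \<sigma>.\<close>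
  have "{f, g} \<in> snd (zero_set_graph X) \<longleftrightarrow> {\<psi> f, \<psi> g} \<in> snd (zero_set_graph Y)"
    if fg: "f \<in> nonunits X" "g \<in> nonunits X" for f g
    using fg \<psi>Z \<sigma>_meet[of "zero_set X f" "zero_set X g"] bij_betw_apply[OF \<psi>]
      inj_on_eq_iff[OF bij_betw_imp_inj_on[OF \<psi>] fg]
    by (simp add: zero_set_graph_def zero_set_graph_on_adjacent_iff)
  with \<psi> show ?thesis
    unfolding graph_isomorphic_def fst_zero_set_graph by blast
qed

end
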